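(* Let $(W,S)$ be a Coxeter system, $(X,\mathrm{ht})$ a quasiparabolic $W$-set, and $\tilde X$ its even double cover, a quasiparabolic $W\times A_1$-set with $A_1=\langle s_0\rangle$. Let $x,y\in X$ with $x<y$ in the Bruhat order on $X$. Then, in the Bruhat order on $\tilde X$, either $s_0\tilde x$ and $\tilde y$ are incomparable or $s_0\tilde x<\tilde y$, and the latter occurs if and only if there exists a chain $$x=x_0<x_1=r_1x_0<x_2=r_2x_1<\cdots<x_k=r_kx_{k-1}=y$$ in $X$, with $r_i\in R(W)$, which at some step increases the height by an even amount (i.e. $\mathrm{ht}(x_i)-\mathrm{ht}(x_{i-1})$ is even for some $i$).
   Context: Coxeter systems $(W,S)$ have finite rank; $R(W)$ is the set of reflections, i.e. conjugates in $W$ of elements of $S$; $\ell$ is the length function. A product $W\times W'$ of Coxeter groups is a Coxeter group with simple reflections $S\sqcup S'$. A scaled $W$-set is a pair $(X,\mathrm{ht})$ with $X$ a (left) $W$-set and $\mathrm{ht}:X\to\mathbb Z$ a function with $|\mathrm{ht}(sx)-\mathrm{ht}(x)|\le 1$ for all $s\in S$, $x\in X$. A quasiparabolic $W$-set is a scaled $W$-set such that (QP1) for all $r\in R(W)$, $x\in X$, if $\mathrm{ht}(rx)=\mathrm{ht}(x)$ then $rx=x$; and (QP2) for all $r\in R(W)$, $x\in X$, $s\in S$, if $\mathrm{ht}(rx)>\mathrm{ht}(x)$ and $\mathrm{ht}(srx)<\mathrm{ht}(sx)$, then $rx=sx$. The Bruhat order on a quasiparabolic $W$-set is the weakest partial order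 such that for $x\in X$, $r\in R(W)$, $x\le rx$ iff $\mathrm{ht}(x)\le\mathrm{ht}(rx)$ (i.e. the reflexive-transitive closure of the relations $x<rx$ with $r \in R(W)$, $\mathrm{ht}(x)<\mathrm{ht}(rx)$). Even double cover: as a set $\tilde X=X\times\mathbb F_2$, with $W$-action $w(x,k)=(wx,k+\ell(w))$ and $A_1$-action $s_0(x,k)=(x,k+1)$; the height is $\widetilde{\mathrm{ht}}(x,k)=\mathrm{ht}(x)$ if $\mathrm{ht}(x)\equiv k\pmod 2$, and $\mathrm{ht}(x)+1$ otherwise. It is known that $\tilde X$ is quasiparabolic as a $W\times A_1$-set when $X$ is quasiparabolic. For $x\in X$, $\tilde x:=(x,\mathrm{ht}(x)\bmod 2)\in\tilde X$. *)

theory Defs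
  imports
    "HOL-Algebra.Group_Action"
    "HOL-Algebra.Elementary_Groups"
    "HOL-Library.Z2"
begin

section \<open>Coxeter systems\<close>

definition word_prod :: "('a, 'm) monoid_scheme \<Rightarrow> 'a list \<Rightarrow> 'a" where
  "word_prod W ws = foldr (\<lambda>a b. a \<otimes>\<^bsub>W\<^esub> b) ws \<one>\<^bsub>W\<^esub>"

text \<open>
  The entry \<open>0\<close> of a Coxeter matrix stands for infinity: the corresponding relator is then the
  empty word, which imposes no relation.
\<close>

definition coxeter_matrix :: "'a set \<Rightarrow> ('a \<Rightarrow> 'a \<Rightarrow> nat) \<Rightarrow> bool" where
  "coxeter_matrix S m \<longleftrightarrow>
     (\<forall>s\<in>S. m s s = 1) \<and>
     (\<forall>s\<in>S. \<forall>t\<in>S. m s t = m t s) \<and>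
     (\<forall>s\<in>S. \<forall>t\<in>S. s \<noteq> t \<longrightarrow> m s t \<noteq> 1)"

inductive coxeter_step :: "'a set \<Rightarrow> ('a \<Rightarrow> 'a \<Rightarrow> nat) \<Rightarrow> 'a list \<Rightarrow> 'a list \<Rightarrow> bool"
  for S m where
  "s \<in> S \<Longrightarrow> t \<in> S \<Longrightarrow>
     coxeter_step S m (us @ concat (replicate (m s t) [s, t]) @ vs) (us @ vs)"

text \<open>
  The last condition says that \<open>W\<close> has the presentation \<open>\<langle>S | (st)^m(s,t) = 1\<rangle>\<close>.  Since
  \<open>m s s = 1\<close> makes every generator an involution, the presented group is already the quotient
  of the free monoid on \<open>S\<close> by the congruence generated by the relations.  The first
  condition is the standing assumption of finite rank.
\<close>

locale coxeter_system = group W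
  for W (structure) and S :: "'a set" +
  assumes finite_rank: "finite S"
    and simple_closed: "S \<subseteq> carrier W"
    and simple_generate: "generate W S = carrier W"
    and presentation: "\<exists>m. coxeter_matrix S m \<and>
      (\<forall>us\<in>lists S. \<forall>vs\<in>lists S.
         word_prod W us = word_prod W vs \<longleftrightarrow> equivclp (coxeter_step S m) us vs)"

definition coxeter_length :: "('a, 'm) monoid_scheme \<Rightarrow> 'a set \<Rightarrow> 'a \<Rightarrow> nat" where
  "coxeter_length W S w = (LEAST n. \<exists>ws\<in>lists S. length ws = n \<and> word_prod W ws = w)"

definition reflections :: "('a, 'm) monoid_scheme \<Rightarrow> 'a set \<Rightarrow> 'a set" where
  "reflections W S = {g \<otimes>\<^bsub>W\<^esub> s \<otimes>\<^bsub>W\<^esub> inv\<^bsub>W\<^esub> g | g s. g \<in> carrier W \<and> s \<in> S}"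

definition prod_simple ::
    "('a, 'm) monoid_scheme \<Rightarrow> 'a set \<Rightarrow> ('b, 'n) monoid_scheme \<Rightarrow> 'b set \<Rightarrow> ('a \<times> 'b) set" where
  "prod_simple W S W' S' = (\<lambda>s. (s, \<one>\<^bsub>W'\<^esub>)) ` S \<union> (\<lambda>s'. (\<one>\<^bsub>W\<^esub>, s')) ` S'"

section \<open>Scaled and quasiparabolic sets\<close>

locale scaled_set = group_action W X act
  for W (structure) and S :: "'a set" and X :: "'x set" and act :: "'a \<Rightarrow> 'x \<Rightarrow> 'x" +
  fixes ht :: "'x \<Rightarrow> int"
  assumes ht_simple: "\<lbrakk>s \<in> S; x \<in> X\<rbrakk> \<Longrightarrow> \<bar>ht (act s x) - ht x\<bar> \<le> 1"

locale quasiparabolic_set = scaled_set W S X act ht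
  for W (structure) and S :: "'a set" and X :: "'x set" and act :: "'a \<Rightarrow> 'x \<Rightarrow> 'x"
    and ht :: "'x \<Rightarrow> int" +
  assumes QP1: "\<lbrakk>r \<in> reflections W S; x \<in> X; ht (act r x) = ht x\<rbrakk> \<Longrightarrow> act r x = x"
    and QP2: "\<lbrakk>r \<in> reflections W S; x \<in> X; s \<in> S;
               ht (act r x) > ht x; ht (act s (act r x)) < ht (act s x)\<rbrakk>
              \<Longrightarrow> act r x = act s x"

definition bruhat_step ::
    "('a, 'm) monoid_scheme \<Rightarrow> 'a set \<Rightarrow> 'x set \<Rightarrow> ('a \<Rightarrow> 'x \<Rightarrow> 'x) \<Rightarrow> ('x \<Rightarrow> int) \<Rightarrow>
     'x \<Rightarrow> 'x \<Rightarrow> bool" where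
  "bruhat_step W S X act ht x y \<longleftrightarrow>
     x \<in> X \<and> (\<exists>r\<in>reflections W S. y = act r x \<and> ht x < ht (act r x))"

definition bruhat_le ::
    "('a, 'm) monoid_scheme \<Rightarrow> 'a set \<Rightarrow> 'x set \<Rightarrow> ('a \<Rightarrow> 'x \<Rightarrow> 'x) \<Rightarrow> ('x \<Rightarrow> int) \<Rightarrow>
     'x \<Rightarrow> 'x \<Rightarrow> bool" where
  "bruhat_le W S X act ht = (bruhat_step W S X act ht)\<^sup>*\<^sup>*"

definition bruhat_less ::
    "('a, 'm) monoid_scheme \<Rightarrow> 'a set \<Rightarrow> 'x set \<Rightarrow> ('a \<Rightarrow> 'x \<Rightarrow> 'x) \<Rightarrow> ('x \<Rightarrow> int) \<Rightarrow>
     'x \<Rightarrow> 'x \<Rightarrow> bool" where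
  "bruhat_less W S X act ht x y \<longleftrightarrow> bruhat_le W S X act ht x y \<and> x \<noteq> y"

section \<open>The even double cover\<close>

definition A1 :: "int monoid" where
  "A1 = integer_mod_group 2"

definition A1_gen :: int ("s\<^sub>0") where
  "s\<^sub>0 = 1"

text \<open>
  Elements of \<open>A1\<close> are the integers \<open>0\<close> (the identity) and \<open>1\<close> (that is, \<open>s\<^sub>0\<close>), so adding the
  second component of a group element to \<open>k\<close> lets \<open>s\<^sub>0\<close> act by \<open>k \<mapsto> k + 1\<close>.
\<close>

definition dc_group :: "('a, 'm) monoid_scheme \<Rightarrow> ('a \<times> int) monoid" where
  "dc_group W = W \<times>\<times> A1"

definition dc_simple :: "('a, 'm) monoid_scheme \<Rightarrow> 'a set \<Rightarrow> ('a \<times> int) set" where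
  "dc_simple W S = prod_simple W S A1 {s\<^sub>0}"

definition dc_set :: "'x set \<Rightarrow> ('x \<times> bit) set" where
  "dc_set X = X \<times> UNIV"

definition dc_act ::
    "('a, 'm) monoid_scheme \<Rightarrow> 'a set \<Rightarrow> 'x set \<Rightarrow> ('a \<Rightarrow> 'x \<Rightarrow> 'x) \<Rightarrow>
     'a \<times> int \<Rightarrow> 'x \<times> bit \<Rightarrow> 'x \<times> bit" where
  "dc_act W S X act = (\<lambda>(w, a).
     restrict (\<lambda>(x, k). (act w x, k + of_nat (coxeter_length W S w) + of_int a)) (dc_set X))"

definition dc_ht :: "('x \<Rightarrow> int) \<Rightarrow> 'x \<times> bit \<Rightarrow> int" where
  "dc_ht ht = (\<lambda>(x, k). if of_int (ht x) = k then ht x else ht x + 1)"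

definition dc_lift :: "('x \<Rightarrow> int) \<Rightarrow> 'x \<Rightarrow> 'x \<times> bit" where
  "dc_lift ht x = (x, of_int (ht x))"

definition dc_le ::
    "('a, 'm) monoid_scheme \<Rightarrow> 'a set \<Rightarrow> 'x set \<Rightarrow> ('a \<Rightarrow> 'x \<Rightarrow> 'x) \<Rightarrow> ('x \<Rightarrow> int) \<Rightarrow>
     'x \<times> bit \<Rightarrow> 'x \<times> bit \<Rightarrow> bool" where
  "dc_le W S X act ht =
     bruhat_le (dc_group W) (dc_simple W S) (dc_set X) (dc_act W S X act) (dc_ht ht)"

definition dc_less ::
    "('a, 'm) monoid_scheme \<Rightarrow> 'a set \<Rightarrow> 'x set \<Rightarrow> ('a \<Rightarrow> 'x \<Rightarrow> 'x) \<Rightarrow> ('x \<Rightarrow> int) \<Rightarrow>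
     'x \<times> bit \<Rightarrow> 'x \<times> bit \<Rightarrow> bool" where
  "dc_less W S X act ht =
     bruhat_less (dc_group W) (dc_simple W S) (dc_set X) (dc_act W S X act) (dc_ht ht)"

end

theory Submission
  imports Defs
begin

text \<open>
  A reflection of \<open>W\<close> has odd length, so every Bruhat step \<open>(z, k) \<rightarrow> (z', k')\<close> of the double
  cover has \<open>k' = k + 1\<close> and \<open>z'\<close> is \<open>z\<close> or a reflection of \<open>z\<close>.  Comparing heights, a step from
  the upper point \<open>(x, ht x + 1)\<close> to a lower point \<open>(y, ht y)\<close> must project to an even increase
  in \<open>X\<close>.  Conversely, a step of \<open>X\<close> lifts to a relation between the two upper
  points and to one between the two lower points: an odd one directly, an even one by
  inserting a step from a lower point to the upper point above it.
\<close>

section \<open>Parity of the length function\<close>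

lemma of_int_bit_eq_iff: "(of_int m :: bit) = of_int n \<longleftrightarrow> even (m - n)"
  by (cases "even m"; cases "even n") (auto elim!: evenE oddE)

lemma bit_add_one: "b + 1 \<noteq> (b :: bit)" "b + 1 + 1 = (b :: bit)" "a \<noteq> b \<longleftrightarrow> a = (b :: bit) + 1"
  by (cases a; cases b; simp)+

text \<open>The deleted relator has length \<open>2 * m s t\<close>, which is even also in the case
  \<open>m s t = 0\<close> standing for infinity.\<close>

lemma coxeter_step_length_parity:
  "coxeter_step S m us vs \<Longrightarrow> even (length us) \<longleftrightarrow> even (length vs)"
  by (induction rule: coxeter_step.induct) (auto simp: length_concat sum_list_replicate)

lemma equivclp_coxeter_step_length_parity:
  "equivclp (coxeter_step S m) us vs \<Longrightarrow> even (length us) \<longleftrightarrow> even (length vs)"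
  by (induction rule: equivclp_induct) (auto dest: coxeter_step_length_parity)

context coxeter_system
begin

lemma word_prod_closed: "ws \<in> lists S \<Longrightarrow> word_prod W ws \<in> carrier W"
  using simple_closed by (induction ws) (auto simp: word_prod_def)

lemma word_prod_append:
  "us \<in> lists S \<Longrightarrow> vs \<in> lists S \<Longrightarrow> word_prod W (us @ vs) = word_prod W us \<otimes> word_prod W vs"
proof (induction us)
  case Nil
  then show ?case using word_prod_closed by (simp add: word_prod_def)
next
  case (Cons a us)
  have "a \<in> carrier W" using Cons.prems simple_closed by auto
  moreover have "word_prod W us \<in> carrier W" "word_prod W vs \<in> carrier W"
    using Cons.prems word_prod_closed by auto
  ultimately show ?case using Cons by (simp add: word_prod_def m_assoc)
qed

lemma word_prod_parity:
  assumes "us \<in> lists S" "vs \<in> lists S" "word_prod W us = word_prod W vs"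
  shows "even (length us) \<longleftrightarrow> even (length vs)"
  using presentation assms equivclp_coxeter_step_length_parity by metis

lemma simple_inv:
  assumes "s \<in> S" shows "inv s = s"
proof -
  obtain m where m: "coxeter_matrix S m"
    "\<forall>us\<in>lists S. \<forall>vs\<in>lists S. word_prod W us = word_prod W vs \<longleftrightarrow> equivclp (coxeter_step S m) us vs"
    using presentation by blast
  \<comment> \<open>Since \<open>m s s = 1\<close>, the relator of the pair \<open>(s, s)\<close> is
    the two-letter word \<open>[s, s]\<close>, so \<open>s\<close> squares to the identity.\<close>
  have "coxeter_step S m ([] @ concat (replicate (m s s) [s, s]) @ []) ([] @ [])"
    using assms by (intro coxeter_step.intros)
  then have "coxeter_step S m [s, s] []"
    using m(1) assms by (simp add: coxeter_matrix_def)
  then have "word_prod W [s, s] = word_prod W []"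
    using m(2) assms by (simp add: r_into_equivclp)
  then have "s \<otimes> s = \<one>" "s \<in> carrier W"
    using assms simple_closed by (auto simp: word_prod_def)
  then show ?thesis by (simp add: inv_equality)
qed

lemma word_exists:
  assumes "g \<in> carrier W"
  shows "\<exists>ws\<in>lists S. word_prod W ws = g"
proof -
  have "g \<in> generate W S" using assms simple_generate by simp
  then show ?thesis
  proof (induction rule: generate.induct)
    case one
    show ?case by (rule bexI[of _ "[]"]) (auto simp: word_prod_def)
  next
    case (incl h)
    then show ?case using simple_closed by (intro bexI[of _ "[h]"]) (auto simp: word_prod_def)
  next
    case (inv h)
    then show ?case
      using simple_closed by (intro bexI[of _ "[h]"]) (auto simp: word_prod_def simple_inv)
  next
    case (eng h1 h2)
    then show ?case by (metis append_in_lists_conv word_prod_append)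
  qed
qed

lemma word_prod_rev: "ws \<in> lists S \<Longrightarrow> word_prod W (rev ws) = inv (word_prod W ws)"
proof (induction ws)
  case Nil
  then show ?case by (simp add: word_prod_def)
next
  case (Cons a ws)
  have a: "a \<in> S" "a \<in> carrier W" using Cons.prems simple_closed by auto
  have w: "word_prod W ws \<in> carrier W" using Cons.prems word_prod_closed by auto
  have "word_prod W (rev (a # ws)) = word_prod W (rev ws) \<otimes> word_prod W [a]"
    using Cons.prems by (simp add: word_prod_append in_lists_conv_set)
  also have "\<dots> = inv (word_prod W ws) \<otimes> inv a"
    using Cons a by (simp add: word_prod_def simple_inv)
  also have "\<dots> = inv (a \<otimes> word_prod W ws)"
    using a w by (simp add: inv_mult_group)
  finally show ?case by (simp add: word_prod_def)
qed

text \<open>The least length is attained by some word, and any two words with the same product have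
  lengths of equal parity.\<close>

lemma coxeter_length_parity:
  assumes "ws \<in> lists S"
  shows "even (coxeter_length W S (word_prod W ws)) \<longleftrightarrow> even (length ws)"
proof -
  have "\<exists>vs\<in>lists S. length vs = coxeter_length W S (word_prod W ws) \<and>
      word_prod W vs = word_prod W ws"
    unfolding coxeter_length_def by (rule LeastI_ex) (use assms in blast)
  then show ?thesis using assms word_prod_parity by metis
qed

lemma coxeter_length_one_even: "even (coxeter_length W S \<one>)"
  using coxeter_length_parity[of "[]"] by (simp add: word_prod_def)

lemma coxeter_length_reflection_odd:
  assumes "r \<in> reflections W S"
  shows "odd (coxeter_length W S r)"
proof -
  obtain g s where gs: "g \<in> carrier W" "s \<in> S" "r = g \<otimes> s \<otimes> inv g"
    using assms by (auto simp: reflections_def)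
  obtain ws where ws: "ws \<in> lists S" "word_prod W ws = g"
    using word_exists[OF gs(1)] by blast
  \<comment> \<open>A word for \<open>g\<close> extends to a palindrome for \<open>r\<close> with
    middle letter \<open>s\<close>, hence of odd length.\<close>
  have "word_prod W (ws @ [s] @ rev ws) = g \<otimes> (s \<otimes> inv g)"
    using ws gs simple_closed word_prod_rev[OF ws(1)]
    by (subst word_prod_append) (auto simp: word_prod_def)
  also have "\<dots> = r"
    using gs simple_closed by (auto simp: m_assoc)
  finally show ?thesis
    using coxeter_length_parity[of "ws @ [s] @ rev ws"] ws(1) gs(2) by (simp add: in_lists_conv_set)
qed

lemma reflections_closed: "reflections W S \<subseteq> carrier W"
  using simple_closed by (auto simp: reflections_def)

section \<open>Reflections of \<open>W \<times> A1\<close>\<close>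

lemma dc_reflections:
  "reflections (dc_group W) (dc_simple W S) = (\<lambda>r. (r, 0)) ` reflections W S \<union> {(\<one>, s\<^sub>0)}"
proof -
  have A1: "group A1" "carrier A1 = {0, 1}" "\<one>\<^bsub>A1\<^esub> = 0"
    "\<And>a b. a \<otimes>\<^bsub>A1\<^esub> b = (a + b) mod 2"
    by (auto simp: A1_def carrier_integer_mod_group)
  have inv_A1: "inv\<^bsub>A1\<^esub> a = (- a) mod 2" if "a \<in> {0, 1}" for a
    using that A1(2) unfolding A1_def by simp
  \<comment> \<open>\<open>A1\<close> is commutative, so conjugation changes only the first
    component; in particular \<open>(\<one>, s\<^sub>0)\<close> is its own only conjugate.\<close>
  have conj: "(g, a) \<otimes>\<^bsub>dc_group W\<^esub> (s, b) \<otimes>\<^bsub>dc_group W\<^esub> inv\<^bsub>dc_group W\<^esub> (g, a) =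
      (g \<otimes> s \<otimes> inv g, b)"
    if "g \<in> carrier W" "a \<in> {0, 1}" "b \<in> {0, 1}" for g s a b
    using that A1 inv_A1[OF that(2)] by (auto simp: dc_group_def inv_DirProd is_group)
  have simple: "dc_simple W S = (\<lambda>s. (s, 0)) ` S \<union> {(\<one>, s\<^sub>0)}"
    by (auto simp: dc_simple_def prod_simple_def A1)
  have carr: "carrier (dc_group W) = carrier W \<times> {0, 1}"
    by (auto simp: dc_group_def A1)
  show ?thesis
  proof (intro equalityI subsetI)
    fix q assume "q \<in> reflections (dc_group W) (dc_simple W S)"
    then obtain g a s b where "g \<in> carrier W" "a \<in> {0, 1}" "(s, b) \<in> dc_simple W S"
      "q = (g, a) \<otimes>\<^bsub>dc_group W\<^esub> (s, b) \<otimes>\<^bsub>dc_group W\<^esub> inv\<^bsub>dc_group W\<^esub> (g, a)"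
      unfolding reflections_def carr by auto
    moreover from this have "b \<in> {0, 1}" by (auto simp: simple A1_gen_def)
    ultimately show "q \<in> (\<lambda>r. (r, 0)) ` reflections W S \<union> {(\<one>, s\<^sub>0)}"
      by (auto simp: conj simple reflections_def A1_gen_def)
  next
    fix q assume "q \<in> (\<lambda>r. (r, 0)) ` reflections W S \<union> {(\<one>, s\<^sub>0)}"
    then consider g s where "g \<in> carrier W" "s \<in> S" "q = (g \<otimes> s \<otimes> inv g, 0)" | "q = (\<one>, s\<^sub>0)"
      by (auto simp: reflections_def)
    then show "q \<in> reflections (dc_group W) (dc_simple W S)"
    proof cases
      case 1
      then have "q = (g, 0) \<otimes>\<^bsub>dc_group W\<^esub> (s, 0) \<otimes>\<^bsub>dc_group W\<^esub> inv\<^bsub>dc_group W\<^esub> (g, 0)"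
        by (simp add: conj)
      then show ?thesis
        unfolding reflections_def carr simple using 1 by blast
    next
      case 2
      then have "q = (\<one>, 0) \<otimes>\<^bsub>dc_group W\<^esub> (\<one>, s\<^sub>0) \<otimes>\<^bsub>dc_group W\<^esub> inv\<^bsub>dc_group W\<^esub> (\<one>, 0)"
        by (simp add: conj A1_gen_def)
      then show ?thesis
        unfolding reflections_def carr simple by blast
    qed
  qed
qed

end

section \<open>Bruhat order on the double cover\<close>

locale quasiparabolic_coxeter_set = coxeter_system W S + quasiparabolic_set W S X act ht
  for W (structure) and S and X :: "'x set" and act and ht
begin

declare add_bit_eq_xor [simp del]

abbreviation "step \<equiv> bruhat_step W S X act ht"
abbreviation "ble \<equiv> bruhat_le W S X act ht"
abbreviation "dc_step \<equiv> bruhat_step (dc_group W) (dc_simple W S) (dc_set X) (dc_act W S X act) (dc_ht ht)"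
abbreviation "dcle \<equiv> dc_le W S X act ht"
text \<open>The fibre over \<open>z\<close> consists of \<open>lower z\<close> at height
  \<open>ht z\<close> and its \<open>s\<^sub>0\<close>-image \<open>upper z\<close>, one
  higher.\<close>

abbreviation lower where "lower \<equiv> dc_lift ht"
abbreviation upper where "upper z \<equiv> (z, of_int (ht z) + 1 :: bit)"

lemma step_ht: "step x y \<Longrightarrow> ht x < ht y"
  by (auto simp: bruhat_step_def)

lemma step_in: "step x y \<Longrightarrow> x \<in> X \<and> y \<in> X"
  using reflections_closed element_image unfolding bruhat_step_def by blast

lemma le_ht: "ble x y \<Longrightarrow> x = y \<or> ht x < ht y"
  unfolding bruhat_le_def by (induction rule: rtranclp_induct) (auto dest: step_ht)

text \<open>Links the chains of the theorem, given by the strict order, to steps given by heights: a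
  strict relation is a nonempty chain of steps, so it raises the height.\<close>

lemma step_iff: "step x y \<longleftrightarrow> bruhat_less W S X act ht x y \<and> (\<exists>r\<in>reflections W S. y = act r x)"
proof
  assume "step x y"
  then show "bruhat_less W S X act ht x y \<and> (\<exists>r\<in>reflections W S. y = act r x)"
    using step_ht[of x y] r_into_rtranclp[of step x y]
    by (auto simp: bruhat_less_def bruhat_le_def bruhat_step_def)
next
  assume *: "bruhat_less W S X act ht x y \<and> (\<exists>r\<in>reflections W S. y = act r x)"
  then have "ble x y" "x \<noteq> y" by (auto simp: bruhat_less_def)
  then have "ht x < ht y" "x \<in> X"
    using le_ht by (auto simp: bruhat_le_def bruhat_step_def elim: converse_rtranclpE)
  then show "step x y" using * by (auto simp: bruhat_step_def)
qed

section \<open>The step relation of the double cover\<close>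

lemma dc_act_gen: "z \<in> X \<Longrightarrow> dc_act W S X act (\<one>, s\<^sub>0) (z, k) = (z, k + 1)"
  using coxeter_length_one_even id_eq_one[symmetric]
  by (auto simp: dc_act_def dc_set_def A1_gen_def elim!: evenE)

lemma dc_act_reflection:
  "r \<in> reflections W S \<Longrightarrow> z \<in> X \<Longrightarrow> dc_act W S X act (r, 0) (z, k) = (act r z, k + 1)"
  using coxeter_length_reflection_odd[of r]
  by (auto simp: dc_act_def dc_set_def elim!: oddE)

lemma dc_step_iff:
  "dc_step (z, k) (z', k') \<longleftrightarrow>
     z \<in> X \<and> k' = k + 1 \<and> (z' = z \<or> (\<exists>r\<in>reflections W S. z' = act r z)) \<and>
     dc_ht ht (z, k) < dc_ht ht (z', k')"
  unfolding bruhat_step_def dc_reflections bex_Un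
  by (auto simp: dc_act_gen dc_act_reflection dc_set_def)

lemma dc_ht_lower [simp]: "dc_ht ht (lower z) = ht z"
  by (simp add: dc_ht_def dc_lift_def)

lemma dc_ht_upper [simp]: "dc_ht ht (upper z) = ht z + 1"
  by (simp add: dc_ht_def)

lemma dcle_trans: "dcle p q \<Longrightarrow> dcle q r \<Longrightarrow> dcle p r"
  unfolding dc_le_def bruhat_le_def by (rule rtranclp_trans)

lemma dcle_dc_stepI: "dc_step p q \<Longrightarrow> dcle p q"
  unfolding dc_le_def bruhat_le_def by (rule r_into_rtranclp)

lemma lower_dcle_upper: "z \<in> X \<Longrightarrow> dcle (lower z) (upper z)"
  using dc_ht_lower[of z] dc_ht_upper[of z]
  by (intro dcle_dc_stepI) (simp add: dc_lift_def dc_step_iff)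

section \<open>Lifting relations from \<open>X\<close>\<close>

lemma dcle_if_step:
  assumes "step z z'" "k' = k + 1" "dc_ht ht (z, k) < dc_ht ht (z', k')"
  shows "dcle (z, k) (z', k')"
proof -
  have "z \<in> X" "\<exists>r\<in>reflections W S. z' = act r z"
    using assms(1) by (auto simp: bruhat_step_def)
  then show ?thesis using assms dc_step_iff by (blast intro: dcle_dc_stepI)
qed

text \<open>The bit and the parity of the height flip together, so the reflection preserves the
  level within the fibre and both points rise by \<open>ht z' - ht z\<close>.\<close>

lemma odd_step_lifts:
  assumes "step z z'" "odd (ht z' - ht z)"
  shows "dcle (lower z) (lower z')" "dcle (upper z) (upper z')"
proof -
  have bit: "(of_int (ht z') :: bit) = of_int (ht z) + 1"
    using assms(2) of_int_bit_eq_iff[of "ht z'" "ht z + 1"] by simp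
  have lt: "ht z < ht z'" using assms(1) by (rule step_ht)
  show "dcle (lower z) (lower z')"
    unfolding dc_lift_def using assms(1) bit
    by (rule dcle_if_step) (use lt in \<open>simp flip: dc_lift_def\<close>)
  show "dcle (upper z) (upper z')"
    using assms(1) arg_cong[OF bit, of "\<lambda>b. b + 1"]
    by (rule dcle_if_step) (unfold dc_ht_upper, use lt in simp)
qed

lemma even_step_lift:
  assumes "step z z'" "even (ht z' - ht z)"
  shows "dcle (upper z) (lower z')"
proof -
  have bit: "(of_int (ht z') :: bit) = of_int (ht z) + 1 + 1"
    using assms(2) of_int_bit_eq_iff[of "ht z'" "ht z"] by simp
  have "ht z < ht z'" using assms(1) by (rule step_ht)
  \<comment> \<open>A positive even increase is at least 2, which leaves room for the extra 1 in the
    height of \<open>upper z\<close>.\<close>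
  then have "ht z + 1 < ht z'" using assms(2) by presburger
  then have "dc_ht ht (upper z) < dc_ht ht (lower z')"
    by (simp only: dc_ht_upper dc_ht_lower)
  then show ?thesis
    unfolding dc_lift_def by (rule dcle_if_step[OF assms(1) bit])
qed

lemma step_lifts:
  assumes "step z z'"
  shows "dcle (lower z) (lower z')" "dcle (upper z) (upper z')"
proof -
  have "dcle (lower z) (lower z') \<and> dcle (upper z) (upper z')"
  proof (cases "even (ht z' - ht z)")
    case True
    \<comment> \<open>Both claims are contained in the chain \<open>lower z\<close>,
      \<open>upper z\<close>, \<open>lower z'\<close>, \<open>upper z'\<close>.\<close>
    have "dcle (lower z) (upper z)" "dcle (lower z') (upper z')"
      using step_in[OF assms] by (simp_all only: lower_dcle_upper)
    with even_step_lift[OF assms True] show ?thesis by (blast intro: dcle_trans)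
  next
    case False
    then show ?thesis using odd_step_lifts[OF assms] by blast
  qed
  then show "dcle (lower z) (lower z')" "dcle (upper z) (upper z')" by blast+
qed

lemma le_lifts:
  assumes "ble z z'"
  shows "dcle (lower z) (lower z')" "dcle (upper z) (upper z')"
proof -
  have "dcle (lower z) (lower z') \<and> dcle (upper z) (upper z')"
    using assms unfolding bruhat_le_def
  proof (induction rule: rtranclp_induct)
    case base
    show ?case by (simp add: dc_le_def bruhat_le_def)
  next
    case (step u v)
    then show ?case
      using dcle_trans[OF _ step_lifts(1)[of u v]] dcle_trans[OF _ step_lifts(2)[of u v]] by simp
  qed
  then show "dcle (lower z) (lower z')" "dcle (upper z) (upper z')" by blast+
qed

section \<open>Even chains and projection to \<open>X\<close>\<close>

definition even_chain :: "'x \<Rightarrow> 'x \<Rightarrow> bool" where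
  "even_chain x y \<longleftrightarrow> (\<exists>a b. ble x a \<and> step a b \<and> even (ht b - ht a) \<and> ble b y)"

text \<open>Cutting a chain at one even step pays off here: prolonging it changes only the tail,
  without any indices.\<close>

lemma even_chain_step: "even_chain x y \<Longrightarrow> step y z \<Longrightarrow> even_chain x z"
  unfolding even_chain_def bruhat_le_def by (meson rtranclp.rtrancl_into_rtrancl)

lemma dc_step_project:
  assumes "dc_step (z, k) (z', k')"
  shows "k' = k + 1" "z' = z \<or> step z z'"
proof -
  have *: "z \<in> X" "k' = k + 1" "z' = z \<or> (\<exists>r\<in>reflections W S. z' = act r z)"
    "dc_ht ht (z, k) < dc_ht ht (z', k')"
    using assms dc_step_iff by blast+
  show "k' = k + 1" by fact
  \<comment> \<open>\<open>dc_ht\<close> exceeds \<open>ht\<close> by 0 or 1, so a strict increase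
    above gives a weak one below. If the heights are equal, \<open>QP1\<close> makes the reflection
    fix \<open>z\<close>.\<close>
  have "ht z \<le> ht z'" using *(4) by (auto simp: dc_ht_def split: if_splits)
  then show "z' = z \<or> step z z'"
    using * QP1 by (force simp: bruhat_step_def)
qed

lemma dcle_project:
  assumes "dcle (x, j) (y, k)"
  shows "ble x y"
proof -
  have "ble x (fst q)" if "dcle (x, j) q" for q
    using that unfolding dc_le_def bruhat_le_def
  proof (induction rule: rtranclp_induct)
    case (step p q)
    then show ?case
      using dc_step_project(2)[of "fst p" "snd p" "fst q" "snd q"]
      by (auto intro: rtranclp.rtrancl_into_rtrancl)
  qed simp
  from this[OF assms] show ?thesis by simp
qed

lemma upper_dcle_lower_iff: "dcle (upper x) (lower y) \<longleftrightarrow> even_chain x y"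
proof
  assume "even_chain x y"
  then show "dcle (upper x) (lower y)"
    \<comment> \<open>Up to the even step the chain lifts to upper points, the even step crosses to
      a lower point, and the rest lifts to lower points.\<close>
    unfolding even_chain_def by (blast intro: dcle_trans le_lifts even_step_lift)
next
  assume reach: "dcle (upper x) (lower y)"
  \<comment> \<open>Invariant along a path from \<open>upper x\<close>: only at lower points is an
    even chain claimed, so the start satisfies it vacuously.\<close>
  have "snd q = of_int (ht (fst q)) \<longrightarrow> even_chain x (fst q)" if "dcle (upper x) q" for q
    using that unfolding dc_le_def bruhat_le_def
  proof (induction rule: rtranclp_induct)
    case base
    show ?case using bit_add_one(1) by simp
  next
    case (step p q)
    obtain z k z' k' where pq: "p = (z, k)" "q = (z', k')" by fastforce
    have dstep: "dc_step (z, k) (z', k')" and le: "ble x z"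
      using step.hyps dcle_project unfolding pq dc_le_def bruhat_le_def by blast+
    have k': "k' = k + 1" and proj: "z' = z \<or> step z z'"
      using dc_step_project[OF dstep] by auto
    have "even_chain x z'" if l: "k' = of_int (ht z')"
    proof (cases "k = of_int (ht z)")
      case True
      \<comment> \<open>Between two lower points the bit changes, so the fibre must change
        too.\<close>
      have "z' \<noteq> z" using True l k' bit_add_one(1) by metis
      then have "step z z'" using proj by blast
      moreover have "even_chain x z" using True step.IH pq by simp
      ultimately show ?thesis by (rule even_chain_step[rotated])
    next
      case False
      \<comment> \<open>Here the path crosses from an upper to a lower point. The parity of the
        height is kept, and staying in the fibre would mean descending, so the projected step is an
        even increase.\<close>
      then have k: "k = of_int (ht z) + 1"
        by (simp only: bit_add_one(3))
      have "(of_int (ht z') :: bit) = of_int (ht z)"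
        using k k' l bit_add_one(2) by metis
      then have "even (ht z' - ht z)"
        by (simp only: of_int_bit_eq_iff)
      moreover have "dc_ht ht (z, k) < dc_ht ht (z', k')"
        using dstep dc_step_iff by blast
      then have "z' \<noteq> z"
        using dc_ht_upper[of z] dc_ht_lower[of z'] unfolding dc_lift_def k l by auto
      ultimately show ?thesis
        using proj le unfolding even_chain_def bruhat_le_def by blast
    qed
    then show ?case using pq by simp
  qed
  from this[OF reach] show "even_chain x y" by (simp add: dc_lift_def)
qed

section \<open>Even chains as indexed sequences\<close>

lemma even_chain_iff_indexed:
  "even_chain x y \<longleftrightarrow>
     (\<exists>(k :: nat) c. c 0 = x \<and> c k = y \<and> (\<forall>i<k. step (c i) (c (Suc i))) \<and>
        (\<exists>i<k. even (ht (c (Suc i)) - ht (c i))))"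
proof
  assume "even_chain x y"
  then obtain a b where ab: "ble x a" "step a b" "even (ht b - ht a)" "ble b y"
    unfolding even_chain_def by blast
  obtain m f where f: "f 0 = x" "f m = a" "\<forall>i<m. step (f i) (f (Suc i))"
    using ab(1) unfolding bruhat_le_def by (meson rtranclp_imp_relpowp relpowp_fun_conv[THEN iffD1])
  obtain n g where g: "g 0 = b" "g n = y" "\<forall>i<n. step (g i) (g (Suc i))"
    using ab(4) unfolding bruhat_le_def by (meson rtranclp_imp_relpowp relpowp_fun_conv[THEN iffD1])
  \<comment> \<open>The shift by \<open>Suc m\<close> makes the even step from \<open>a\<close> to
    \<open>b\<close> the link between positions \<open>m\<close> and \<open>Suc m\<close>.\<close>
  define c where "c i = (if i \<le> m then f i else g (i - Suc m))" for i
  have "step (c i) (c (Suc i))" if "i < Suc m + n" for i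
  proof (cases i m rule: linorder_cases)
    case less
    then show ?thesis using f by (simp add: c_def)
  next
    case equal
    then show ?thesis using f g ab by (simp add: c_def)
  next
    case greater
    then have "step (g (i - Suc m)) (g (Suc (i - Suc m)))" using g that by simp
    moreover have "Suc (i - Suc m) = Suc i - Suc m" using greater by simp
    ultimately show ?thesis using greater by (simp add: c_def)
  qed
  moreover have "c 0 = x" "c (Suc m + n) = y" "even (ht (c (Suc m)) - ht (c m))"
    using f g ab by (auto simp: c_def)
  ultimately show "\<exists>(k :: nat) c. c 0 = x \<and> c k = y \<and> (\<forall>i<k. step (c i) (c (Suc i))) \<and>
      (\<exists>i<k. even (ht (c (Suc i)) - ht (c i)))"
    by (intro exI[of _ "Suc m + n"] exI[of _ c] conjI exI[of _ m]) auto
next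
  assume "\<exists>(k :: nat) c. c 0 = x \<and> c k = y \<and> (\<forall>i<k. step (c i) (c (Suc i))) \<and>
      (\<exists>i<k. even (ht (c (Suc i)) - ht (c i)))"
  then obtain k c i where c: "c 0 = x" "c k = y" "\<forall>i<k. step (c i) (c (Suc i))"
    "i < k" "even (ht (c (Suc i)) - ht (c i))"
    by blast
  have chain: "ble (c p) (c q)" if "p \<le> q" "q \<le> k" for p q
    using that
  proof (induction q rule: dec_induct)
    case (step n)
    then show ?case
      using c(3) unfolding bruhat_le_def by (auto intro: rtranclp.rtrancl_into_rtrancl)
  qed (simp add: bruhat_le_def)
  have "ble x (c i)" "ble (c (Suc i)) y"
    using chain[of 0 i] chain[of "Suc i" k] c by auto
  then show "even_chain x y" unfolding even_chain_def using c by blast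
qed

end

theorem lemma5p7:
  fixes W :: "('a, 'm) monoid_scheme" and S :: "'a set"
    and X :: "'x set" and act :: "'a \<Rightarrow> 'x \<Rightarrow> 'x" and ht :: "'x \<Rightarrow> int"
    and x y :: 'x
  assumes "coxeter_system W S"
    and "quasiparabolic_set W S X act ht"
    and "x \<in> X" and "y \<in> X"
    and "bruhat_less W S X act ht x y"
  shows "let s0x = dc_act W S X act (\<one>\<^bsub>W\<^esub>, s\<^sub>0) (dc_lift ht x); y' = dc_lift ht y in
           ((\<not> dc_le W S X act ht s0x y' \<and> \<not> dc_le W S X act ht y' s0x)
              \<or> dc_less W S X act ht s0x y')
         \<and> (dc_less W S X act ht s0x y' \<longleftrightarrow>
             (\<exists>(k :: nat) (c :: nat \<Rightarrow> 'x).
                c 0 = x \<and> c k = y \<and>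
                (\<forall>i<k. bruhat_less W S X act ht (c i) (c (Suc i)) \<and>
                       (\<exists>r\<in>reflections W S. c (Suc i) = act r (c i))) \<and>
                (\<exists>i<k. even (ht (c (Suc i)) - ht (c i)))))"
proof -
  interpret C: coxeter_system W S by fact
  interpret Q: quasiparabolic_set W S X act ht by fact
  interpret quasiparabolic_coxeter_set W S X act ht ..
  have upper: "dc_act W S X act (\<one>\<^bsub>W\<^esub>, s\<^sub>0) (dc_lift ht x) = upper x"
    unfolding dc_lift_def by (rule dc_act_gen[OF assms(3)])
  have le: "ble x y" and ne: "x \<noteq> y" using assms(5) by (auto simp: bruhat_less_def)
  have less_iff: "dc_less W S X act ht (upper x) (lower y) \<longleftrightarrow> dcle (upper x) (lower y)"
    using ne by (auto simp: dc_less_def bruhat_less_def dc_le_def dc_lift_def)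
  \<comment> \<open>Such a relation would project to \<open>ble y x\<close>, against the strict rise
    in height from \<open>x\<close> to \<open>y\<close>. Hence comparability leaves only the other
    direction.\<close>
  have "\<not> dcle (lower y) (upper x)"
    using dcle_project[of y _ x] le_ht[OF le] le_ht[of y x] ne by (force simp: dc_lift_def)
  then show ?thesis
    unfolding upper Let_def less_iff upper_dcle_lower_iff even_chain_iff_indexed step_iff
    by blast
qed

end
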